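(* Let $X$ be a complete topologized semilattice, let $Y$ be an $\omega$-Lawson semitopological semilattice, and let $h:X\to Y$ be a continuous homomorphism. Then the image $h(X)$ is closed in $Y$.
   Context: A semilattice is a commutative semigroup all of whose elements are idempotents ($xx=x$). It carries the natural partial order $x\le y$ iff $xy=x$. A subset $C$ of a semilattice is a chain if $xy\in\{x,y\}$ for all $x,y\in C$. A topologized semilattice is a semilattice endowed with a topology (no compatibility with the operation is assumed); it is semitopological if its operation $(x,y)\mapsto xy$ is separately continuous. A topologized semilattice $X$ is complete if for each non-empty chain $C\subset X$ both $\inf C$ and $\sup C$ (with respect to the natural partial order) exist in $X$ and belong to the closure $\overline{C}$ of $C$ in $X$. A closed neighborhood of a point $x$ is a closed set containing $x$ in its interior. A topologized semilattice $Y$ is $\omega$-Lawson if for any distinct points $x,y\in Y$ there exists a countable family $\mathcal U$ of closed neighborhoods of $x$ such that $\bigcap\mathcal U$ is a subsemilattice of $Y$ that does not contain $y$. *)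

theory Defs
  imports "HOL-Analysis.Analysis" "HOL-Library.Lub_Glb"
begin

text \<open>
  The semilattice product $xy$ is \<^const>\<open>inf\<close>. The order of the class
  \<^class>\<open>semilattice_inf\<close> is the natural one: \<open>x \<le> y \<longleftrightarrow> inf x y = x\<close> (fact \<open>le_iff_inf\<close>).
\<close>

definition semilattice_chain :: "'a::semilattice_inf set \<Rightarrow> bool"
  where "semilattice_chain C \<longleftrightarrow> (\<forall>x\<in>C. \<forall>y\<in>C. inf x y \<in> {x, y})"

definition subsemilattice :: "'a::semilattice_inf set \<Rightarrow> bool"
  where "subsemilattice S \<longleftrightarrow> (\<forall>x\<in>S. \<forall>y\<in>S. inf x y \<in> S)"

definition semilattice_hom :: "('a::semilattice_inf \<Rightarrow> 'b::semilattice_inf) \<Rightarrow> bool"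
  where "semilattice_hom h \<longleftrightarrow> (\<forall>x y. h (inf x y) = inf (h x) (h y))"

definition closed_neighborhood :: "'a::topological_space \<Rightarrow> 'a set \<Rightarrow> bool"
  where "closed_neighborhood x U \<longleftrightarrow> closed U \<and> x \<in> interior U"

text \<open>No compatibility between the topology and the operation or order is assumed.\<close>

class topologized_semilattice = topological_space + semilattice_inf

text \<open>The remaining notions are properties of the whole space \<open>'a\<close>, passed as \<open>TYPE('a)\<close>.\<close>

definition semitopological_semilattice :: "'a::topologized_semilattice itself \<Rightarrow> bool"
  where "semitopological_semilattice _ \<longleftrightarrow>
    (\<forall>a::'a. continuous_on UNIV (\<lambda>x. inf a x) \<and> continuous_on UNIV (\<lambda>x. inf x a))"

definition complete_semilattice :: "'a::topologized_semilattice itself \<Rightarrow> bool"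
  where "complete_semilattice _ \<longleftrightarrow>
    (\<forall>C::'a set. C \<noteq> {} \<and> semilattice_chain C \<longrightarrow>
      (\<exists>i. isGlb UNIV C i \<and> i \<in> closure C) \<and>
      (\<exists>s. isLub UNIV C s \<and> s \<in> closure C))"

definition omega_Lawson :: "'a::topologized_semilattice itself \<Rightarrow> bool"
  where "omega_Lawson _ \<longleftrightarrow>
    (\<forall>x y::'a. x \<noteq> y \<longrightarrow>
      (\<exists>\<U>. countable \<U> \<and> (\<forall>U\<in>\<U>. closed_neighborhood x U) \<and>
        subsemilattice (\<Inter>\<U>) \<and> y \<notin> \<Inter>\<U>))"

end

theory Submission
  imports Defs
begin

text \<open>
  Let \<open>y\<close> be a point of the closure of \<open>range h\<close>, and call a countable intersection of closed
  neighborhoods of \<open>y\<close> that is a subsemilattice a trap of \<open>y\<close>. The \<open>\<omega>\<close>-Lawson property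
  says that the traps of \<open>y\<close> have only the point \<open>y\<close> in common. So it is enough to find one \<open>x\<close>
  whose image lies in every trap, and then \<open>h x = y\<close>. This takes two steps, one for countably many
  neighborhoods and one for arbitrarily many traps.

  For countably many neighborhoods (\<open>hom_meets_countable_neighborhoods\<close>) separate continuity and
  \<open>yy = y\<close> allow the choice of points \<open>x\<^sub>0, x\<^sub>1, \<dots>\<close> whose images are so close to \<open>y\<close> that
  all finite products \<open>x\<^sub>i \<cdots> x\<^sub>n\<close> are mapped into the \<open>i\<close>-th neighborhood. Completeness of the
  domain turns these products into a single point, their lower limit
  \<open>sup\<^sub>i inf\<^sub>n x\<^sub>i \<cdots> x\<^sub>n\<close>. Both the infimum and the supremum are taken over chains, hence they lie
  in the closures of these chains and the neighborhoods, being closed, retain them.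

  It follows that the preimages of the traps are nonempty closed subsemilattices. They are closed
  under binary intersections, because a union of two countable families is countable. A complete
  semilattice is compact with respect to closed subsemilattices
  (\<open>closed_subsemilattices_compactness\<close>): each of them has a least element, and in a decreasing
  chain of them these least elements increase to a common point. So the preimages of all the traps
  have a common point.
\<close>

section \<open>Chains in complete semilattices\<close>

lemma semilattice_chain_iff_comparable:
  "semilattice_chain C \<longleftrightarrow> (\<forall>x\<in>C. \<forall>y\<in>C. x \<le> y \<or> y \<le> x)"
  by (simp add: semilattice_chain_def inf.absorb_iff1 inf.commute)

lemma semilattice_chain_image:
  assumes "\<And>i j. i \<in> A \<Longrightarrow> j \<in> A \<Longrightarrow> f i \<le> f j \<or> f j \<le> f i"
  shows "semilattice_chain (f ` A)"
  using assms by (simp add: semilattice_chain_iff_comparable)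

lemma complete_semilattice_lower_limit:
  fixes C :: "'a::topologized_semilattice set"
  assumes "complete_semilattice TYPE('a)" "semilattice_chain C" "C \<noteq> {}"
  obtains i where "i \<in> closure C" "\<And>c. c \<in> C \<Longrightarrow> i \<le> c" "\<And>b. (\<And>c. c \<in> C \<Longrightarrow> b \<le> c) \<Longrightarrow> b \<le> i"
proof -
  obtain i where i: "isGlb UNIV C i" "i \<in> closure C"
    using assms unfolding complete_semilattice_def by blast
  show thesis
    by (rule that[of i])
      (use i in \<open>auto simp: isGlb_def greatestP_def isLb_def setge_def setle_def\<close>)
qed

text \<open>
  A final segment of a chain has the same supremum as the chain. So the supremum belongs to the
  closure of each final segment, and the chain converges to it as far as closed sets can tell.
\<close>

lemma complete_semilattice_upper_limit:
  fixes C :: "'a::topologized_semilattice set"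
  assumes comp: "complete_semilattice TYPE('a)" and C: "semilattice_chain C" "C \<noteq> {}"
  obtains s where "\<And>K c. closed K \<Longrightarrow> c \<in> C \<Longrightarrow> (\<And>x. x \<in> C \<Longrightarrow> c \<le> x \<Longrightarrow> x \<in> K) \<Longrightarrow> s \<in> K"
proof -
  obtain s where s: "isLub UNIV C s"
    using comp C unfolding complete_semilattice_def by blast
  have "s \<in> K" if "closed K" "c \<in> C" and K: "\<And>x. x \<in> C \<Longrightarrow> c \<le> x \<Longrightarrow> x \<in> K" for K c
  proof -
    let ?T = "{x \<in> C. c \<le> x}"
    have "semilattice_chain ?T"
      using C(1) unfolding semilattice_chain_def by blast
    moreover have "?T \<noteq> {}"
      using \<open>c \<in> C\<close> by blast
    ultimately have "\<exists>t. isLub UNIV ?T t \<and> t \<in> closure ?T"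
      using comp unfolding complete_semilattice_def by meson
    then obtain t where t: "isLub UNIV ?T t" "t \<in> closure ?T" by blast
    have "isUb UNIV C t"
    proof (intro isUbI setleI ballI)
      fix x assume "x \<in> C"
      then consider "c \<le> x" | "x \<le> c"
        using C \<open>c \<in> C\<close> by (auto simp: semilattice_chain_iff_comparable)
      moreover have "x \<le> t" if "x \<in> ?T" for x
        using t(1) that by (auto simp: isLub_def leastP_def isUb_def setle_def)
      ultimately show "x \<le> t"
        using \<open>x \<in> C\<close> \<open>c \<in> C\<close> by (metis (mono_tags, lifting) mem_Collect_eq order_refl order_trans)
    qed simp
    then have "s \<le> t"
      using s by (simp add: isLub_def leastP_def setge_def)
    moreover have "t \<le> s"
      using s t(1) by (auto simp: isLub_def leastP_def setge_def isUb_def setle_def)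
    moreover have "closure ?T \<subseteq> K"
      using \<open>closed K\<close> K by (intro closure_minimal) auto
    ultimately show ?thesis
      using t(2) by auto
  qed
  then show thesis by (rule that)
qed

section \<open>Compactness for closed subsemilattices\<close>

lemma subsemilattice_Inter: "(\<And>S. S \<in> \<S> \<Longrightarrow> subsemilattice S) \<Longrightarrow> subsemilattice (\<Inter>\<S>)"
  by (simp add: subsemilattice_def)

lemma subsemilattice_Int: "subsemilattice S \<Longrightarrow> subsemilattice T \<Longrightarrow> subsemilattice (S \<inter> T)"
  by (simp add: subsemilattice_def)

text \<open>
  Closedness keeps the infima of chains in the set, so Zorn's lemma yields a minimal element; in a
  subsemilattice a minimal element is below every \<open>s\<close>, since its product with \<open>s\<close> cannot be
  strictly smaller.
\<close>

lemma closed_subsemilattice_has_least: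
  fixes S :: "'a::topologized_semilattice set"
  assumes comp: "complete_semilattice TYPE('a)"
    and S: "closed S" "subsemilattice S" "S \<noteq> {}"
  shows "\<exists>m\<in>S. \<forall>s\<in>S. m \<le> s"
proof -
  have "\<exists>m\<in>S. \<forall>s\<in>S. m \<ge> s \<longrightarrow> s = m"
  proof (rule predicate_Zorn)
    show "partial_order_on S (relation_of (\<ge>) S)"
      by (rule partial_order_on_relation_ofI) auto
    fix C assume C: "C \<in> Chains (relation_of (\<ge>) S)"
    then have sub: "C \<subseteq> S"
      by (auto simp: Chains_def relation_of_def)
    have chain: "semilattice_chain C"
      using C by (auto simp: Chains_def relation_of_def semilattice_chain_iff_comparable)
    show "\<exists>u\<in>S. \<forall>a\<in>C. a \<ge> u"
    proof (cases "C = {}")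
      case True
      then show ?thesis using S(3) by blast
    next
      case False
      then obtain i where "i \<in> closure C" "\<And>c. c \<in> C \<Longrightarrow> i \<le> c"
        using complete_semilattice_lower_limit[OF comp chain] by metis
      then show ?thesis
        using closure_minimal[OF sub S(1)] by blast
    qed
  qed
  then obtain m where m: "m \<in> S" "\<And>s. s \<in> S \<Longrightarrow> s \<le> m \<Longrightarrow> s = m"
    by blast
  have "m \<le> s" if "s \<in> S" for s
    using m that S(2) unfolding subsemilattice_def by (metis inf.cobounded1 inf.cobounded2)
  then show ?thesis using m(1) by blast
qed

text \<open>
  The least elements of the members of a decreasing chain form an increasing chain, whose supremum
  belongs to every member.
\<close>

lemma closed_subsemilattices_chain_compactness:
  fixes \<K> :: "'a::topologized_semilattice set set"
  assumes comp: "complete_semilattice TYPE('a)"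
    and ne: "\<K> \<noteq> {}"
    and \<K>: "\<And>K. K \<in> \<K> \<Longrightarrow> closed K \<and> subsemilattice K \<and> K \<noteq> {}"
    and chain: "\<And>K L. K \<in> \<K> \<Longrightarrow> L \<in> \<K> \<Longrightarrow> K \<subseteq> L \<or> L \<subseteq> K"
  shows "\<Inter>\<K> \<noteq> {}"
proof -
  have "\<exists>m\<in>K. \<forall>s\<in>K. m \<le> s" if "K \<in> \<K>" for K
    using \<K>[OF that] by (intro closed_subsemilattice_has_least[OF comp]) auto
  then obtain m where m: "\<And>K. K \<in> \<K> \<Longrightarrow> m K \<in> K" "\<And>K s. K \<in> \<K> \<Longrightarrow> s \<in> K \<Longrightarrow> m K \<le> s"
    by metis
  have mono: "m L \<le> m K" if "K \<in> \<K>" "L \<in> \<K>" "K \<subseteq> L" for K L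
    using m that by blast
  have "semilattice_chain (m ` \<K>)"
    using mono chain by (intro semilattice_chain_image) meson
  moreover have "m ` \<K> \<noteq> {}"
    using ne by simp
  ultimately obtain s where s: "\<And>K c. closed K \<Longrightarrow> c \<in> m ` \<K> \<Longrightarrow>
      (\<And>x. x \<in> m ` \<K> \<Longrightarrow> c \<le> x \<Longrightarrow> x \<in> K) \<Longrightarrow> s \<in> K"
    using complete_semilattice_upper_limit[OF comp] by blast
  have "s \<in> K" if "K \<in> \<K>" for K
  proof (rule s[of K "m K"])
    fix x assume "x \<in> m ` \<K>" "m K \<le> x"
    then obtain L where L: "L \<in> \<K>" "x = m L" by blast
    show "x \<in> K"
    proof (cases "L \<subseteq> K")
      case True
      then show ?thesis using L m(1) by blast
    next
      case False
      then have "m L \<le> m K" using chain[OF that L(1)] mono[OF that L(1)] by blast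
      then show ?thesis using \<open>m K \<le> x\<close> L m(1)[OF that] by auto
    qed
  qed (use that \<K> in auto)
  then show ?thesis by blast
qed

text \<open>
  Zorn's lemma is applied to the subfamilies \<open>\<F>\<close> whose intersection meets every member of \<open>\<S>\<close>.
  Compactness for chains makes this property inductive, and since \<open>\<S>\<close> is closed under
  intersections, the property survives when one member of \<open>\<S>\<close> is added to \<open>\<F>\<close>. So the whole of
  \<open>\<S>\<close> has it.
\<close>

lemma closed_subsemilattices_compactness:
  fixes \<S> :: "'a::topologized_semilattice set set"
  assumes comp: "complete_semilattice TYPE('a)"
    and ne: "\<S> \<noteq> {}"
    and \<S>: "\<And>S. S \<in> \<S> \<Longrightarrow> closed S \<and> subsemilattice S \<and> S \<noteq> {}"
    and Int: "\<And>S T. S \<in> \<S> \<Longrightarrow> T \<in> \<S> \<Longrightarrow> S \<inter> T \<in> \<S>"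
  shows "\<Inter>\<S> \<noteq> {}"
proof -
  define \<A> where "\<A> = {\<F>. \<F> \<subseteq> \<S> \<and> (\<forall>S\<in>\<S>. S \<inter> \<Inter>\<F> \<noteq> {})}"
  have "{} \<in> \<A>"
    using \<S> by (auto simp: \<A>_def)
  have "\<exists>\<M>\<in>\<A>. \<forall>\<F>\<in>\<A>. \<M> \<subseteq> \<F> \<longrightarrow> \<F> = \<M>"
  proof (rule subset_Zorn_nonempty)
    show "\<A> \<noteq> {}" using \<open>{} \<in> \<A>\<close> by blast
    fix \<C> assume "\<C> \<noteq> {}" and "subset.chain \<A> \<C>"
    then have sub: "\<C> \<subseteq> \<A>" and lin: "\<And>\<F> \<G>. \<F> \<in> \<C> \<Longrightarrow> \<G> \<in> \<C> \<Longrightarrow> \<F> \<subseteq> \<G> \<or> \<G> \<subseteq> \<F>"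
      by (auto simp: subset_chain_def)
    have "S \<inter> \<Inter>(\<Union>\<C>) \<noteq> {}" if "S \<in> \<S>" for S
    proof -
      have "\<Inter>((\<lambda>\<F>. S \<inter> \<Inter>\<F>) ` \<C>) \<noteq> {}"
      proof (rule closed_subsemilattices_chain_compactness[OF comp])
        fix K assume "K \<in> (\<lambda>\<F>. S \<inter> \<Inter>\<F>) ` \<C>"
        then obtain \<F> where \<F>: "\<F> \<in> \<C>" "K = S \<inter> \<Inter>\<F>" by blast
        then have "\<F> \<subseteq> \<S>" "K \<noteq> {}"
          using sub that by (auto simp: \<A>_def)
        then show "closed K \<and> subsemilattice K \<and> K \<noteq> {}"
          using \<F> \<S> that
          by (auto intro!: closed_Int closed_Inter subsemilattice_Int subsemilattice_Inter)
      next
        fix K L assume "K \<in> (\<lambda>\<F>. S \<inter> \<Inter>\<F>) ` \<C>" "L \<in> (\<lambda>\<F>. S \<inter> \<Inter>\<F>) ` \<C>"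
        then obtain \<F> \<G> where "\<F> \<in> \<C>" "\<G> \<in> \<C>" "K = S \<inter> \<Inter>\<F>" "L = S \<inter> \<Inter>\<G>"
          by blast
        then show "K \<subseteq> L \<or> L \<subseteq> K"
          using lin[of \<F> \<G>] by blast
      qed (use \<open>\<C> \<noteq> {}\<close> in simp)
      then show ?thesis using \<open>\<C> \<noteq> {}\<close> by blast
    qed
    then show "\<Union>\<C> \<in> \<A>"
      using sub by (auto simp: \<A>_def)
  qed
  then obtain \<M> where \<M>: "\<M> \<in> \<A>" "\<And>\<F>. \<F> \<in> \<A> \<Longrightarrow> \<M> \<subseteq> \<F> \<Longrightarrow> \<F> = \<M>"
    by blast
  have "S \<in> \<M>" if "S \<in> \<S>" for S
  proof -
    have "T \<inter> \<Inter>(insert S \<M>) \<noteq> {}" if "T \<in> \<S>" for T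
      using \<M>(1) Int[OF that \<open>S \<in> \<S>\<close>] by (auto simp: \<A>_def Int_assoc)
    then have "insert S \<M> \<in> \<A>"
      using \<M>(1) that by (auto simp: \<A>_def)
    then show ?thesis using \<M>(2) by blast
  qed
  then have "\<Inter>\<M> \<subseteq> \<Inter>\<S>" by blast
  moreover have "\<Inter>\<M> \<noteq> {}"
    using \<M>(1) ne by (auto simp: \<A>_def)
  ultimately show ?thesis by blast
qed

section \<open>Countably many neighborhoods\<close>

lemma semitopological_translation_open:
  fixes a :: "'a::topologized_semilattice"
  assumes "semitopological_semilattice TYPE('a)" "open V"
  shows "open {z. inf a z \<in> V}"
proof -
  have "continuous_on UNIV (\<lambda>z. inf a z)"
    using assms(1) by (simp add: semitopological_semilattice_def)
  then show ?thesis
    using open_vimage[OF assms(2)] by (simp add: vimage_def)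
qed

text \<open>
  In the array \<open>f\<close> the entry \<open>f n i\<close>, for \<open>i \<le> n\<close>, is the product \<open>x\<^sub>i \<cdots> x\<^sub>n\<close> of points chosen one
  after the other. To be able to choose the next point, it is necessary to keep also the products
  \<open>h (f n i) y\<close> in the neighborhoods: these are what \<open>h (f n i) z\<close> and \<open>h (f n i) z y\<close> tend to as
  \<open>z\<close> approaches \<open>y\<close>.
\<close>

lemma product_array_exists:
  fixes h :: "'x::semilattice_inf \<Rightarrow> 'y::topologized_semilattice"
  assumes semitop: "semitopological_semilattice TYPE('y)"
    and hom: "semilattice_hom h"
    and y: "y \<in> closure (range h)"
    and V: "\<And>n::nat. open (V n)" "\<And>n. y \<in> V n"
  obtains f :: "nat \<Rightarrow> nat \<Rightarrow> 'x"
  where "\<And>n i. i \<le> n \<Longrightarrow> h (f n i) \<in> V i"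
    and "\<And>n i. i < n \<Longrightarrow> f n i \<le> f n (Suc i)"
    and "\<And>n i. i \<le> n \<Longrightarrow> f (Suc n) i \<le> f n i"
proof -
  have approx: "\<exists>x. h x \<in> W" if "open W" "y \<in> W" for W
    using y that unfolding closure_iff_nhds_not_empty by blast
  define Q where "Q n P \<longleftrightarrow> (\<forall>i\<le>n. h (P i) \<in> V i \<and> inf (h (P i)) y \<in> V i) \<and>
    (\<forall>i<n. P i \<le> P (Suc i))" for n and P :: "nat \<Rightarrow> 'x"
  have new: "open {z \<in> V n. inf y z \<in> V n}" "y \<in> {z \<in> V n. inf y z \<in> V n}" for n
    using V semitopological_translation_open[OF semitop V(1)] by (auto intro: open_Collect_conj)
  have "\<exists>f. \<forall>n. Q n (f n) \<and> (\<forall>i\<le>n. f (Suc n) i \<le> f n i)"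
  proof (rule dependent_nat_choice)
    obtain x where "h x \<in> {z \<in> V 0. inf y z \<in> V 0}"
      using approx new by meson
    then have "Q 0 (\<lambda>_. x)"
      by (auto simp: Q_def inf_commute)
    then show "\<exists>P. Q 0 P" by (rule exI[of "Q 0"])
  next
    fix P n assume Q: "Q n P"
    \<comment> \<open>\<open>W i\<close> consists of the \<open>z\<close> that keep the invariant in column \<open>i\<close> after multiplication.\<close>
    define W where "W i = {z. inf (h (P i)) z \<in> V i} \<inter> {z. inf (inf (h (P i)) y) z \<in> V i}" for i
    let ?W = "{z \<in> V (Suc n). inf y z \<in> V (Suc n)} \<inter> (\<Inter>i\<in>{..n}. W i)"
    have "open (W i)" for i
      unfolding W_def using semitopological_translation_open[OF semitop V(1)] by (intro open_Int)
    moreover have "y \<in> W i" if "i \<le> n" for i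
      using Q that by (auto simp: Q_def W_def inf_assoc)
    ultimately have "open ?W" "y \<in> ?W"
      using new by (auto intro!: open_Int)
    then obtain x where x: "h x \<in> ?W"
      using approx by meson
    define P' where "P' i = (if i \<le> n then inf (P i) x else x)" for i
    have "h (P' i) \<in> V i \<and> inf (h (P' i)) y \<in> V i" if "i \<le> Suc n" for i
    proof (cases "i \<le> n")
      case True
      then have "h x \<in> W i" using x by blast
      moreover have "h (P' i) = inf (h (P i)) (h x)"
        using True hom by (simp add: P'_def semilattice_hom_def)
      ultimately show ?thesis
        by (simp add: W_def inf.assoc inf.commute[of "h x" y])
    next
      case False
      then have "i = Suc n" using that by simp
      then show ?thesis using x by (auto simp: P'_def inf_commute)
    qed
    moreover have "P' i \<le> P' (Suc i)" if "i < Suc n" for i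
      using Q that unfolding Q_def P'_def by (auto intro: inf_mono le_infI1 le_infI2)
    ultimately have "Q (Suc n) P'"
      by (auto simp: Q_def)
    moreover have "\<forall>i\<le>n. P' i \<le> P i"
      by (simp add: P'_def)
    ultimately show "\<exists>P'. Q (Suc n) P' \<and> (\<forall>i\<le>n. P' i \<le> P i)" by blast
  qed
  then obtain f where "\<And>n. Q n (f n)" "\<And>n i. i \<le> n \<Longrightarrow> f (Suc n) i \<le> f n i"
    by blast
  then show thesis
    by (intro that[of f]) (simp_all add: Q_def)
qed

text \<open>
  The required point is the lower limit \<open>sup\<^sub>i inf\<^sub>n f n i\<close> of the array of products. For
  each \<open>i\<close> the products \<open>f n i\<close> decrease with \<open>n\<close>, so the closed sets around \<open>y\<close> that contain
  their images contain the image of their infimum \<open>e i\<close> as well. The points \<open>e i\<close> increase with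
  \<open>i\<close>, because omitting the first factor makes a product larger, and so their supremum inherits
  each condition that holds from some \<open>i\<close> on.
\<close>

lemma hom_meets_countable_neighborhoods:
  fixes h :: "'x::topologized_semilattice \<Rightarrow> 'y::topologized_semilattice"
  assumes comp: "complete_semilattice TYPE('x)"
    and semitop: "semitopological_semilattice TYPE('y)"
    and cont: "continuous_on UNIV h"
    and hom: "semilattice_hom h"
    and y: "y \<in> closure (range h)"
    and \<U>: "countable \<U>" "\<And>U. U \<in> \<U> \<Longrightarrow> closed_neighborhood y U"
  shows "\<exists>x. h x \<in> \<Inter>\<U>"
proof (cases "\<U> = {}")
  case False
  define U where "U = from_nat_into \<U>"
  have U: "range U = \<U>"
    unfolding U_def using False \<U>(1) by (rule range_from_nat_into)
  have nbhd: "closed (U n)" "y \<in> interior (U n)" for n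
    using \<U>(2) U by (auto simp: closed_neighborhood_def)
  have pre: "closed (h -` U n)" for n
    using nbhd(1) cont by (rule closed_vimage)
  \<comment> \<open>Decreasing neighborhoods make the \<open>i\<close>-th column respect all \<open>U k\<close> with \<open>k \<le> i\<close>.\<close>
  define V where "V n = (\<Inter>k\<in>{..n}. interior (U k))" for n
  have V: "open (V n)" "y \<in> V n" for n
    using nbhd by (auto simp: V_def)
  obtain f where f: "\<And>n i. i \<le> n \<Longrightarrow> h (f n i) \<in> V i"
    and row: "\<And>n i. i < n \<Longrightarrow> f n i \<le> f n (Suc i)"
    and col: "\<And>n i. i \<le> n \<Longrightarrow> f (Suc n) i \<le> f n i"
    using product_array_exists[where V = V, OF semitop hom y V] by metis
  have col': "f n i \<le> f m i" if "i \<le> m" "m \<le> n" for i m n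
    using that(2,1) by (induction rule: dec_induct) (auto intro: order_trans col)
  have "\<exists>e. e \<in> closure ((\<lambda>n. f n i) ` {i..}) \<and> (\<forall>n\<ge>i. e \<le> f n i) \<and>
      (\<forall>b. (\<forall>n\<ge>i. b \<le> f n i) \<longrightarrow> b \<le> e)" for i
  proof -
    have "semilattice_chain ((\<lambda>n. f n i) ` {i..})"
      using col' by (intro semilattice_chain_image) (meson atLeast_iff linear)
    then obtain e where "e \<in> closure ((\<lambda>n. f n i) ` {i..})"
        "\<And>c. c \<in> (\<lambda>n. f n i) ` {i..} \<Longrightarrow> e \<le> c"
        "\<And>b. (\<And>c. c \<in> (\<lambda>n. f n i) ` {i..} \<Longrightarrow> b \<le> c) \<Longrightarrow> b \<le> e"
      using complete_semilattice_lower_limit[OF comp, of "(\<lambda>n. f n i) ` {i..}"] by auto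
    then show ?thesis by (intro exI[of _ e]) auto
  qed
  then obtain e where e: "\<And>i. e i \<in> closure ((\<lambda>n. f n i) ` {i..})"
      "\<And>i n. i \<le> n \<Longrightarrow> e i \<le> f n i" "\<And>i b. (\<And>n. i \<le> n \<Longrightarrow> b \<le> f n i) \<Longrightarrow> b \<le> e i"
    by metis
  have eU: "e i \<in> h -` U k" if "k \<le> i" for i k
  proof -
    have "(\<lambda>n. f n i) ` {i..} \<subseteq> h -` U k"
      using f interior_subset[of "U k"] that by (fastforce simp: V_def)
    then show ?thesis
      using closure_minimal[OF _ pre] e(1)[of i] by blast
  qed
  have "e i \<le> e (Suc i)" for i
  proof (rule e(3))
    fix n assume "Suc i \<le> n"
    then show "e i \<le> f n (Suc i)"
      using e(2)[of i n] row[of i n] by auto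
  qed
  then have mono: "e i \<le> e j" if "i \<le> j" for i j
    using that by (rule lift_Suc_mono_le)
  have "semilattice_chain (range e)"
    using mono by (intro semilattice_chain_image) (meson linear)
  then obtain s where s: "\<And>K c. closed K \<Longrightarrow> c \<in> range e \<Longrightarrow>
      (\<And>x. x \<in> range e \<Longrightarrow> c \<le> x \<Longrightarrow> x \<in> K) \<Longrightarrow> s \<in> K"
    using complete_semilattice_upper_limit[OF comp] by blast
  have "s \<in> h -` U k" for k
  proof (rule s[OF pre, of "e k"])
    fix x assume "x \<in> range e" "e k \<le> x"
    then obtain i where i: "x = e i" by blast
    show "x \<in> h -` U k"
    proof (cases "k \<le> i")
      case True
      then show ?thesis using eU i by simp
    next
      case False
      then have "e i = e k"
        using mono[of i k] \<open>e k \<le> x\<close> i by (simp add: order_antisym)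
      then show ?thesis using eU[of k k] i by simp
    qed
  qed simp
  then have "h s \<in> \<Inter>\<U>"
    using U by auto
  then show ?thesis ..
qed simp

section \<open>Closedness of the image\<close>

theorem corollary1:
  fixes h :: "'x::topologized_semilattice \<Rightarrow> 'y::topologized_semilattice"
  assumes "complete_semilattice TYPE('x)"
    and "semitopological_semilattice TYPE('y)"
    and "omega_Lawson TYPE('y)"
    and "continuous_on UNIV h"
    and "semilattice_hom h"
  shows "closed (range h)"
proof -
  have "y \<in> range h" if y: "y \<in> closure (range h)" for y
  proof -
    define \<T> where "\<T> = {\<U>. countable \<U> \<and> (\<forall>U\<in>\<U>. closed_neighborhood y U) \<and>
      subsemilattice (\<Inter>\<U>)}"
    have "\<Inter>((\<lambda>\<U>. h -` \<Inter>\<U>) ` \<T>) \<noteq> {}"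
    proof (rule closed_subsemilattices_compactness[OF assms(1)])
      have "{} \<in> \<T>" by (simp add: \<T>_def subsemilattice_def)
      then show "(\<lambda>\<U>. h -` \<Inter>\<U>) ` \<T> \<noteq> {}" by blast
    next
      fix S assume "S \<in> (\<lambda>\<U>. h -` \<Inter>\<U>) ` \<T>"
      then obtain \<U> where \<U>: "\<U> \<in> \<T>" "S = h -` \<Inter>\<U>" by blast
      have "closed S"
        unfolding \<U>(2) using \<U>(1) assms(4)
        by (intro closed_vimage closed_Inter) (auto simp: \<T>_def closed_neighborhood_def)
      moreover have "subsemilattice S"
        using \<U> assms(5) unfolding \<T>_def subsemilattice_def semilattice_hom_def
        by (simp only: vimage_eq mem_Collect_eq) blast
      moreover have "S \<noteq> {}"
      proof -
        have "\<exists>x. h x \<in> \<Inter>\<U>"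
          using \<U>(1)
          by (intro hom_meets_countable_neighborhoods[OF assms(1,2,4,5) y]) (auto simp: \<T>_def)
        then show ?thesis
          unfolding \<U>(2) by blast
      qed
      ultimately show "closed S \<and> subsemilattice S \<and> S \<noteq> {}" by blast
    next
      fix S T assume "S \<in> (\<lambda>\<U>. h -` \<Inter>\<U>) ` \<T>" "T \<in> (\<lambda>\<U>. h -` \<Inter>\<U>) ` \<T>"
      then obtain \<U> \<V> where UV: "\<U> \<in> \<T>" "\<V> \<in> \<T>" "S = h -` \<Inter>\<U>" "T = h -` \<Inter>\<V>" by blast
      have "\<U> \<union> \<V> \<in> \<T>"
        using UV(1,2) by (auto simp: \<T>_def Inter_Un_distrib intro: subsemilattice_Int)
      moreover have "S \<inter> T = h -` \<Inter>(\<U> \<union> \<V>)"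
        using UV(3,4) by auto
      ultimately show "S \<inter> T \<in> (\<lambda>\<U>. h -` \<Inter>\<U>) ` \<T>" by blast
    qed
    then obtain x where "x \<in> \<Inter>((\<lambda>\<U>. h -` \<Inter>\<U>) ` \<T>)" by (auto simp only: ex_in_conv[symmetric])
    then have x: "h x \<in> \<Inter>\<U>" if "\<U> \<in> \<T>" for \<U>
      using that by (simp only: INT_iff vimage_eq)
    have "h x = y"
    proof (rule ccontr)
      assume "h x \<noteq> y"
      then obtain \<U> where "\<U> \<in> \<T>" "h x \<notin> \<Inter>\<U>"
        using assms(3) unfolding omega_Lawson_def \<T>_def mem_Collect_eq by metis
      then show False using x by blast
    qed
    then show ?thesis by blast
  qed
  then show ?thesis
    by (meson closure_subset_eq subsetI)
qed

end
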